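(* Consider the two-stage stochastic integer program with one-dimensional integral first-stage variable $$\min\Big\{c\,x+\sum_{s\in S}p^s d^{\top}y^s:\ T^sx+Wy^s\ge h^s,\ y^s\in\mathbb{R}^{n_2}_+\ \forall s\in S,\ x\in\mathbb{X}\Big\},\qquad \mathbb{X}\subseteq\mathbb{Z}.$$ Then: (1) There is no Lagrangian duality gap for this problem, i.e. its optimal value equals the optimal value of its Lagrangian dual relaxation $$\min\Big\{c\,x+\sum_{s\in S}p^s\theta^s:\ (x,\theta^s)\in\mathrm{conv}(E^s)\ \ \forall s\in S\Big\}.$$ (2) If $\mathcal{N}_1,\mathcal{N}_2$ are two partitions of $S$ such that $\mathcal{N}_1$ is a refinement of $\mathcal{N}_2$, then $z^{\mathcal{N}_1}\ge z^{\mathcal{N}_2}$, where $z^{\mathcal{N}}$ denotes the optimal value of the partition-based problem associated with $\mathcal{N}$.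
   Context: $S$ is a finite set of scenarios, $p^s>0$ is the probability of scenario $s$ ($\sum_{s\in S}p^s=1$), $c\in\mathbb{R}$, $d\in\mathbb{R}^{n_2}$, $W\in\mathbb{R}^{m_2\times n_2}$ (independent of the scenario), and $T^s\in\mathbb{R}^{m_2}$ (an $m_2\times 1$ matrix), $h^s\in\mathbb{R}^{m_2}$ for each $s\in S$. For each scenario, $Q_s(x)=\min\{d^{\top}y: Wy\ge h^s-T^sx,\ y\in\mathbb{R}^{n_2}_+\}$ and $E^s=\{(x,\theta^s)\in\mathbb{X}\times\mathbb{R}:\theta^s\ge Q_s(x)\}$; $\mathrm{conv}$ denotes convex hull. The Lagrangian dual relaxation is the one obtained by dualizing the nonanticipativity constraints (requiring the scenario copies of $x$ to be equal); its feasible region is $\{(x,(\theta^s)_{s\in S}):(x,\theta^s)\in\mathrm{conv}(E^s)\ \forall s\in S\}$. A partition $\mathcal{N}$ of $S$ is a collection of nonempty pairwise disjoint subsets with union $S$. $\mathcal{N}_1$ is a refinement of $\mathcal{N}_2$ if every $\mathcal{P}\in\mathcal{N}_1$ is contained in some $\mathcal{P}'\in\mathcal{N}_2$ and $|\mathcal{N}_1|>|\mathcal{N}_2|$. For $\mathcal{P}\subseteq S$ nonempty put $p^{\mathcal{P}}=\sum_{s\in\mathcal{P}}p^s$, $\bar T^{\mathcal{P}}=\frac{1}{p^{\mathcal{P}}}\sum_{s\in\mathcal{P}}p^sT^s$, $\bar h^{\mathcal{P}}=\frac{1}{p^{\mathcal{P}}}\sum_{s\in\mathcal{P}}p^sh^s$.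 The partition-based problem associated with $\mathcal{N}$ is $$\min\Big\{c\,x+\sum_{\mathcal{P}\in\mathcal{N}}p^{\mathcal{P}}d^{\top}y^{\mathcal{P}}:\ \bar T^{\mathcal{P}}x+Wy^{\mathcal{P}}\ge\bar h^{\mathcal{P}},\ y^{\mathcal{P}}\in\mathbb{R}^{n_2}_+\ \forall\mathcal{P}\in\mathcal{N},\ x\in\mathbb{X}\Big\}.$$ Minima denote optimal values in $[-\infty,+\infty]$ (infima, equal to $+\infty$ when infeasible). *)

theory Defs
  imports "HOL-Analysis.Analysis" "HOL-Library.Disjoint_Sets"
begin

text \<open>
  Conventions: \<open>\<le>\<close> on vectors is the componentwise order; every ``min'' is an infimum in
  \<^typ>\<open>ereal\<close>, hence \<open>\<infinity>\<close> for an infeasible problem and \<open>-\<infinity>\<close> for an unbounded one.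
  A family of decision vectors indexed by \<open>S\<close> (or by a partition of \<open>S\<close>) is a function whose
  values outside the index set enter neither the constraints nor the objective.
\<close>

definition recourse_cost ::
    "real^'n \<Rightarrow> real^'n^'m \<Rightarrow> real^'m \<Rightarrow> real^'m \<Rightarrow> real \<Rightarrow> ereal" where
  "recourse_cost d W Ts hs x =
     (INF y \<in> {y. 0 \<le> y \<and> W *v y \<ge> hs - x *\<^sub>R Ts}. ereal (d \<bullet> y))"

definition scenario_set ::
    "real set \<Rightarrow> real^'n \<Rightarrow> real^'n^'m \<Rightarrow> real^'m \<Rightarrow> real^'m \<Rightarrow> (real \<times> real) set" where
  "scenario_set X d W Ts hs = {(x, \<theta>). x \<in> X \<and> ereal \<theta> \<ge> recourse_cost d W Ts hs x}"

definition two_stage_value ::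
    "'s set \<Rightarrow> ('s \<Rightarrow> real) \<Rightarrow> real set \<Rightarrow> real \<Rightarrow> real^'n \<Rightarrow> real^'n^'m
      \<Rightarrow> ('s \<Rightarrow> real^'m) \<Rightarrow> ('s \<Rightarrow> real^'m) \<Rightarrow> ereal" where
  "two_stage_value S p X c d W T h =
     (INF (x, y) \<in> {(x, y :: 's \<Rightarrow> real^'n).
                      x \<in> X \<and> (\<forall>s\<in>S. x *\<^sub>R T s + W *v y s \<ge> h s \<and> 0 \<le> y s)}.
        ereal (c * x + (\<Sum>s\<in>S. p s * (d \<bullet> y s))))"

text \<open>
  Optimal value of the relaxation obtained by dualizing nonanticipativity. The variable \<open>x\<close> is
  constrained only through the convex hulls, so it need not belong to \<open>X\<close>.
\<close>

definition lagrangian_dual_value ::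
    "'s set \<Rightarrow> ('s \<Rightarrow> real) \<Rightarrow> real set \<Rightarrow> real \<Rightarrow> real^'n \<Rightarrow> real^'n^'m
      \<Rightarrow> ('s \<Rightarrow> real^'m) \<Rightarrow> ('s \<Rightarrow> real^'m) \<Rightarrow> ereal" where
  "lagrangian_dual_value S p X c d W T h =
     (INF (x, \<theta>) \<in> {(x, \<theta> :: 's \<Rightarrow> real).
                      \<forall>s\<in>S. (x, \<theta> s) \<in> convex hull (scenario_set X d W (T s) (h s))}.
        ereal (c * x + (\<Sum>s\<in>S. p s * \<theta> s)))"

definition cond_mean :: "('s \<Rightarrow> real) \<Rightarrow> ('s \<Rightarrow> real^'m) \<Rightarrow> 's set \<Rightarrow> real^'m" where
  "cond_mean p v P = (1 / sum p P) *\<^sub>R (\<Sum>s\<in>P. p s *\<^sub>R v s)"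

definition partition_value ::
    "'s set set \<Rightarrow> ('s \<Rightarrow> real) \<Rightarrow> real set \<Rightarrow> real \<Rightarrow> real^'n \<Rightarrow> real^'n^'m
      \<Rightarrow> ('s \<Rightarrow> real^'m) \<Rightarrow> ('s \<Rightarrow> real^'m) \<Rightarrow> ereal" where
  "partition_value N p X c d W T h =
     (INF (x, y) \<in> {(x, y :: 's set \<Rightarrow> real^'n).
                      x \<in> X \<and> (\<forall>P\<in>N. x *\<^sub>R cond_mean p T P + W *v y P \<ge> cond_mean p h P
                                      \<and> 0 \<le> y P)}.
        ereal (c * x + (\<Sum>P\<in>N. sum p P * (d \<bullet> y P))))"

text \<open>The library's \<^const>\<open>refines\<close> allows equality of the two partitions; here it is excluded.\<close>

definition strictly_refines :: "'s set \<Rightarrow> 's set set \<Rightarrow> 's set set \<Rightarrow> bool" where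
  "strictly_refines S N1 N2 \<longleftrightarrow> refines S N1 N2 \<and> card N1 > card N2"

end

theory Submission
  imports Defs
begin

text \<open>
  \<^emph>\<open>No duality gap.\<close> Write \<open>F s\<close> for the epigraph of the recourse cost of scenario \<open>s\<close> over
  all real \<open>x\<close>. It is convex, because \<open>x\<close> enters the second-stage constraints linearly
  (\<open>convex_recourse_epigraph\<close>), and the set whose hull appears in the dual is the part of \<open>F s\<close>
  above \<open>X\<close>. A dual point with \<open>x \<in> X\<close> therefore already lies in every \<open>F s\<close>, so the recourse
  problems have decisions of at most its cost, up to an arbitrarily small error. If \<open>x \<notin> X\<close>,
  let \<open>a < x < b\<close> be the neighbours of \<open>x\<close> in \<open>X\<close>. In dimension one, a point of the hull above the gap \<open>(a, b)\<close>
  is a convex combination of a point of \<open>F s\<close> above \<open>a\<close> and one above \<open>b\<close>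
  (\<open>hull_of_slices_over_gap\<close>). The decisive point is that the weights \<open>(b - x) / (b - a)\<close> and
  \<open>(x - a) / (b - a)\<close> depend on \<open>x\<close> only and so are the same for all scenarios: the whole dual
  point, objective included, is a convex combination of two points that satisfy nonanticipativity
  with first stages \<open>a\<close> and \<open>b\<close>, and the better of the two is at least as good as the dual point.
  In higher dimension the scenarios could be forced to use different representations of the same \<open>x\<close>.
  Integrality enters only through the existence of the neighbours, for which it suffices that \<open>X\<close> is
  closed; a set of integers is.

  \<^emph>\<open>Monotonicity.\<close> Multiplied by the probability of its block, the constraint of a block is the
  sum over its scenarios of \<open>p s\<close> times the scenario data, hence additive over disjoint blocks.
  Averaging a solution for the finer partition, weighted by probability, over the blocks inside
  each coarse block gives a solution for the coarser partition with the same objective (\<open>partition_value_mono_refines\<close>).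
\<close>

section \<open>Convexity of the recourse cost\<close>

text \<open>
  The infimum defining the recourse cost can be \<open>-\<infinity>\<close>, but that it lies below a real
  bound still gives nearly optimal second-stage decisions; all later
  arguments use the recourse cost only through this reformulation.
\<close>

lemma recourse_cost_le_iff:
  "recourse_cost d W Ts hs x \<le> ereal \<theta> \<longleftrightarrow>
     (\<forall>e>0. \<exists>y. 0 \<le> y \<and> hs \<le> x *\<^sub>R Ts + W *v y \<and> d \<bullet> y \<le> \<theta> + e)"
  (is "?L \<longleftrightarrow> ?R")
proof
  assume L: ?L
  show ?R
  proof (intro allI impI)
    fix e :: real assume "e > 0"
    with L have "recourse_cost d W Ts hs x < ereal (\<theta> + e)"
      by (metis ereal_less_eq(3) leD leI less_add_same_cancel1 order_trans)
    then show "\<exists>y. 0 \<le> y \<and> hs \<le> x *\<^sub>R Ts + W *v y \<and> d \<bullet> y \<le> \<theta> + e"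
      unfolding recourse_cost_def INF_less_iff
      by (auto simp: diff_le_eq add.commute intro: less_imp_le)
  qed
next
  assume R: ?R
  show ?L
  proof (rule ereal_le_epsilon2)
    fix e :: real assume "e > 0"
    with R obtain y where y: "0 \<le> y" "hs \<le> x *\<^sub>R Ts + W *v y" "d \<bullet> y \<le> \<theta> + e"
      by blast
    have "recourse_cost d W Ts hs x \<le> ereal (d \<bullet> y)"
      unfolding recourse_cost_def
      by (rule INF_lower) (use y in \<open>simp add: diff_le_eq add.commute\<close>)
    also have "\<dots> \<le> ereal \<theta> + ereal e"
      using y by simp
    finally show "recourse_cost d W Ts hs x \<le> ereal \<theta> + ereal e" .
  qed
qed

text \<open>
  Convex combinations of second-stage decisions at two values of \<open>x\<close> are feasible at the
  corresponding combination of these values, with the combined cost.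
\<close>

lemma convex_recourse_epigraph: "convex (scenario_set UNIV d W Ts hs)"
proof (rule convexI)
  fix q r :: "real \<times> real" and u v :: real
  assume q: "q \<in> scenario_set UNIV d W Ts hs" and r: "r \<in> scenario_set UNIV d W Ts hs"
    and uv: "0 \<le> u" "0 \<le> v" "u + v = 1"
  obtain x1 t1 x2 t2 where qr: "q = (x1, t1)" "r = (x2, t2)"
    by (metis surj_pair)
  have "recourse_cost d W Ts hs (u * x1 + v * x2) \<le> ereal (u * t1 + v * t2)"
    unfolding recourse_cost_le_iff
  proof (intro allI impI)
    fix e :: real assume "e > 0"
    then obtain y1 y2 where
        y1: "0 \<le> y1" "hs \<le> x1 *\<^sub>R Ts + W *v y1" "d \<bullet> y1 \<le> t1 + e" and
        y2: "0 \<le> y2" "hs \<le> x2 *\<^sub>R Ts + W *v y2" "d \<bullet> y2 \<le> t2 + e"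
      using q r by (force simp: qr scenario_set_def recourse_cost_le_iff)
    have "hs = u *\<^sub>R hs + v *\<^sub>R hs"
      by (metis scaleR_add_left scaleR_one uv(3))
    also have "\<dots> \<le> u *\<^sub>R (x1 *\<^sub>R Ts + W *v y1) + v *\<^sub>R (x2 *\<^sub>R Ts + W *v y2)"
      by (intro add_mono scaleR_left_mono y1 y2 uv)
    also have "\<dots> = (u * x1 + v * x2) *\<^sub>R Ts + W *v (u *\<^sub>R y1 + v *\<^sub>R y2)"
      by (simp add: algebra_simps)
    finally have "hs \<le> \<dots>" .
    moreover have "d \<bullet> (u *\<^sub>R y1 + v *\<^sub>R y2) \<le> u * t1 + v * t2 + e"
    proof -
      have "u * (d \<bullet> y1) + v * (d \<bullet> y2) \<le> u * (t1 + e) + v * (t2 + e)"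
        by (intro add_mono mult_left_mono y1 y2 uv)
      also have "\<dots> = u * t1 + v * t2 + (u + v) * e"
        by (simp add: algebra_simps)
      finally show ?thesis using uv by (simp add: inner_simps)
    qed
    moreover have "0 \<le> u *\<^sub>R y1 + v *\<^sub>R y2"
      by (intro add_nonneg_nonneg scaleR_nonneg_nonneg y1 y2 uv)
    ultimately show "\<exists>y. 0 \<le> y \<and> hs \<le> (u * x1 + v * x2) *\<^sub>R Ts + W *v y \<and>
        d \<bullet> y \<le> u * t1 + v * t2 + e"
      by blast
  qed
  then show "u *\<^sub>R q + v *\<^sub>R r \<in> scenario_set UNIV d W Ts hs"
    by (simp add: qr scenario_set_def)
qed

section \<open>Slices of a planar convex set over a closed set of abscissae\<close>

lemma convex_fst_le: "convex {q :: real \<times> real. fst q \<le> a}"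
  and convex_fst_ge: "convex {q :: real \<times> real. fst q \<ge> a}"
proof -
  have "{q :: real \<times> real. fst q \<le> a} = {..a} \<times> UNIV"
    and "{q :: real \<times> real. fst q \<ge> a} = {a..} \<times> UNIV" by auto
  then show "convex {q :: real \<times> real. fst q \<le> a}" "convex {q :: real \<times> real. fst q \<ge> a}"
    by (simp_all add: convex_Times)
qed

text \<open>
  The gap splits the slices of \<open>F\<close> over \<open>X\<close> into a part left of \<open>a\<close> and a part right of \<open>b\<close>, so a
  point of the hull above the gap lies on a chord joining these parts. By convexity the chord stays
  in \<open>F\<close>, and where it crosses the vertical lines at \<open>a\<close> and \<open>b\<close> it meets the two points wanted.
  The relation between \<open>\<theta>\<close>, \<open>\<alpha>\<close> and \<open>\<beta>\<close> says that an affine function interpolates its values at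
  \<open>a\<close> and \<open>b\<close>.
\<close>

lemma hull_of_slices_over_gap:
  fixes F :: "(real \<times> real) set"
  assumes F: "convex F" and gap: "X \<inter> {a<..<b} = {}" and x: "a < x" "x < b"
    and hull: "(x, \<theta>) \<in> convex hull {q \<in> F. fst q \<in> X}"
  obtains \<alpha> \<beta> where "(a, \<alpha>) \<in> F" "(b, \<beta>) \<in> F"
    "(b - a) * \<theta> = (b - x) * \<alpha> + (x - a) * \<beta>"
proof -
  define L where "L = F \<inter> {q. fst q \<le> a}"
  define R where "R = F \<inter> {q. fst q \<ge> b}"
  have cL: "convex L" and cR: "convex R"
    unfolding L_def R_def by (intro convex_Int F convex_fst_le convex_fst_ge)+
  have "{q \<in> F. fst q \<in> X} \<subseteq> L \<union> R"
    using gap by (fastforce simp: L_def R_def)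
  with hull have hLR: "(x, \<theta>) \<in> convex hull (L \<union> R)"
    using hull_mono by blast
  have L0: "L \<noteq> {}"
  proof
    assume "L = {}"
    with hLR have "(x, \<theta>) \<in> R" using cR by (simp add: hull_same)
    with x show False by (simp add: R_def)
  qed
  have R0: "R \<noteq> {}"
  proof
    assume "R = {}"
    with hLR have "(x, \<theta>) \<in> L" using cL by (simp add: hull_same)
    with x show False by (simp add: L_def)
  qed
  obtain u v q1 q2 where uv: "u \<ge> 0" "v \<ge> 0" "u + v = 1"
      and q: "q1 \<in> L" "q2 \<in> R" "(x, \<theta>) = u *\<^sub>R q1 + v *\<^sub>R q2"
    using hLR unfolding convex_hull_union_two[OF cL L0 cR R0] by blast
  obtain x1 t1 x2 t2 where "q1 = (x1, t1)" "q2 = (x2, t2)"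
    by (metis surj_pair)
  with q have q1: "(x1, t1) \<in> L" and q2: "(x2, t2) \<in> R"
    and eq: "(x, \<theta>) = u *\<^sub>R (x1, t1) + v *\<^sub>R (x2, t2)" by simp_all
  have x1: "x1 \<le> a" "(x1, t1) \<in> F" and x2: "b \<le> x2" "(x2, t2) \<in> F"
    using q1 q2 by (auto simp: L_def R_def)
  define D where "D = x2 - x1"
  have D: "D > 0" using x x1 x2 by (simp add: D_def)
  \<comment> \<open>\<open>\<l>\<close> is the height of the chord; \<open>N\<close> is kept apart so that identities for it are polynomial.\<close>
  define N where "N = (\<lambda>z. (x2 - z) * t1 + (z - x1) * t2)"
  define \<l> where "\<l> = (\<lambda>z. N z / D)"
  have chord: "(z, \<l> z) \<in> F" if "x1 \<le> z" "z \<le> x2" for z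
  proof -
    have "((x2 - z) / D) *\<^sub>R (x1, t1) + ((z - x1) / D) *\<^sub>R (x2, t2) \<in> F"
    proof (rule convexD[OF F x1(2) x2(2)])
      show "0 \<le> (x2 - z) / D" "0 \<le> (z - x1) / D" using that D by simp_all
      show "(x2 - z) / D + (z - x1) / D = 1"
        using D by (simp add: D_def flip: add_divide_distrib)
    qed
    also have "((x2 - z) / D) *\<^sub>R (x1, t1) + ((z - x1) / D) *\<^sub>R (x2, t2) = (z, \<l> z)"
    proof -
      have "(x2 - z) * x1 + (z - x1) * x2 = z * D" by (simp add: D_def algebra_simps)
      then have "(x2 - z) / D * x1 + (z - x1) / D * x2 = z"
        using D by (simp flip: add_divide_distrib)
      then show ?thesis by (simp add: \<l>_def N_def add_divide_distrib)
    qed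
    finally show ?thesis .
  qed
  have "\<l> x = \<theta>"
  proof -
    have xe: "x = u * x1 + v * x2" "\<theta> = u * t1 + v * t2" using eq by auto
    have u: "u = 1 - v" using uv by simp
    have "x2 - x = u * D" "x - x1 = v * D"
      unfolding xe D_def u by (simp_all add: algebra_simps)
    then have "N x = D * \<theta>" unfolding N_def xe(2) by (simp add: algebra_simps)
    then show ?thesis using D by (simp add: \<l>_def)
  qed
  moreover have "(b - a) * \<l> x = (b - x) * \<l> a + (x - a) * \<l> b"
  proof -
    have "(b - a) * N x = (b - x) * N a + (x - a) * N b"
      by (simp add: N_def algebra_simps)
    then show ?thesis by (simp add: \<l>_def flip: add_divide_distrib)
  qed
  ultimately have "(b - a) * \<theta> = (b - x) * \<l> a + (x - a) * \<l> b"
    by simp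
  moreover have "(a, \<l> a) \<in> F" "(b, \<l> b) \<in> F"
    using x x1 x2 by (auto intro!: chord)
  ultimately show thesis using that by blast
qed

text \<open>
  Were there no point of \<open>X\<close> on one side of \<open>x\<close>, then \<open>X\<close> and with it the projection of the hull
  would lie in an open half-line that ends at \<open>x\<close>.
\<close>

lemma hull_of_slices_between:
  fixes F :: "(real \<times> real) set"
  assumes hull: "(x, \<theta>) \<in> convex hull {q \<in> F. fst q \<in> X}"
  obtains l r where "l \<in> X" "l \<le> x" "r \<in> X" "x \<le> r"
proof -
  have inside: "x \<in> I" if I: "convex I" "X \<subseteq> I" for I
  proof -
    have "convex hull {q \<in> F. fst q \<in> X} \<subseteq> I \<times> UNIV"
      using I by (intro hull_minimal convex_Times convex_UNIV) auto
    with hull show ?thesis by auto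
  qed
  have "\<exists>l\<in>X. l \<le> x"
    using inside[of "{x<..}"] by (force simp: not_le)
  moreover have "\<exists>r\<in>X. x \<le> r"
    using inside[of "{..<x}"] by (force simp: not_le)
  ultimately show thesis using that by blast
qed

lemma closed_set_gap_around:
  fixes X :: "real set"
  assumes X: "closed X" "x \<notin> X" and lo: "l \<in> X" "l \<le> x" and hi: "r \<in> X" "x \<le> r"
  obtains a b where "a \<in> X" "b \<in> X" "a < x" "x < b" "X \<inter> {a<..<b} = {}"
proof -
  define a where "a = Sup (X \<inter> {..x})"
  define b where "b = Inf (X \<inter> {x..})"
  have bdd: "bdd_above (X \<inter> {..x})" "bdd_below (X \<inter> {x..})" by auto
  have "a \<in> X \<inter> {..x}" unfolding a_def
    using X lo bdd by (intro closed_contains_Sup) auto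
  moreover have "b \<in> X \<inter> {x..}" unfolding b_def
    using X hi bdd by (intro closed_contains_Inf) auto
  moreover have "z \<le> a \<or> b \<le> z" if "z \<in> X" for z
    using that bdd cSup_upper[of z "X \<inter> {..x}"] cInf_lower[of z "X \<inter> {x..}"]
    unfolding a_def b_def by (cases "z \<le> x") auto
  ultimately have ab: "a \<in> X" "a \<le> x" "b \<in> X" "x \<le> b"
    and sep: "\<And>z. z \<in> X \<Longrightarrow> z \<le> a \<or> b \<le> z" by auto
  have "a < x" "x < b" using ab X(2) by (metis order_le_less)+
  moreover have "X \<inter> {a<..<b} = {}" using sep by fastforce
  ultimately show thesis using ab that by blast
qed

section \<open>The Lagrangian dual has no gap\<close>

text \<open>
  For a common first stage \<open>x \<in> X\<close>, a second-stage decision within \<open>e\<close> of \<open>\<theta> s\<close> in each scenario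
  loses only \<open>e\<close> in total, because the probabilities sum to one.
\<close>

lemma two_stage_value_le_dual_point:
  assumes S: "finite S" and pos: "\<And>s. s \<in> S \<Longrightarrow> p s > 0" and one: "(\<Sum>s\<in>S. p s) = 1"
    and x: "x \<in> X" and \<theta>: "\<And>s. s \<in> S \<Longrightarrow> (x, \<theta> s) \<in> scenario_set UNIV d W (T s) (h s)"
  shows "two_stage_value S p X c d W T h \<le> ereal (c * x + (\<Sum>s\<in>S. p s * \<theta> s))"
proof (rule ereal_le_epsilon2)
  fix e :: real assume "e > 0"
  then have "\<forall>s\<in>S. \<exists>y. 0 \<le> y \<and> h s \<le> x *\<^sub>R T s + W *v y \<and> d \<bullet> y \<le> \<theta> s + e"
    using \<theta> by (simp add: scenario_set_def recourse_cost_le_iff)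
  then obtain y where y: "\<And>s. s \<in> S \<Longrightarrow> 0 \<le> y s \<and> h s \<le> x *\<^sub>R T s + W *v y s \<and> d \<bullet> y s \<le> \<theta> s + e"
    by metis
  have "two_stage_value S p X c d W T h \<le> ereal (c * x + (\<Sum>s\<in>S. p s * (d \<bullet> y s)))"
    unfolding two_stage_value_def
    by (rule INF_lower2[of "(x, y)"]) (use x y in auto)
  also have "(\<Sum>s\<in>S. p s * (d \<bullet> y s)) \<le> (\<Sum>s\<in>S. p s * (\<theta> s + e))"
    using y pos by (intro sum_mono mult_left_mono) (auto intro: less_imp_le)
  also have "(\<Sum>s\<in>S. p s * (\<theta> s + e)) = (\<Sum>s\<in>S. p s * \<theta> s) + e"
    using one by (simp add: distrib_left sum.distrib flip: sum_distrib_right)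
  finally show "two_stage_value S p X c d W T h \<le> ereal (c * x + (\<Sum>s\<in>S. p s * \<theta> s)) + ereal e"
    by (simp add: add.assoc)
qed

text \<open>
  Off \<open>X\<close>, the point of the dual is split at the neighbours \<open>a\<close> and \<open>b\<close> of its abscissa, with weights
  shared by all scenarios; closedness of \<open>X\<close> is what makes \<open>a\<close> and \<open>b\<close> elements of \<open>X\<close>.
\<close>

theorem no_duality_gap_closed_first_stage:
  fixes d :: "real^'n" and W :: "real^'n^'m"
  assumes S: "finite S" and pos: "\<And>s. s \<in> S \<Longrightarrow> p s > 0" and one: "(\<Sum>s\<in>S. p s) = 1"
    and X: "closed X"
  shows "two_stage_value S p X c d W T h = lagrangian_dual_value S p X c d W T h"
proof (rule antisym)
  let ?V = "two_stage_value S p X c d W T h"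
  let ?F = "\<lambda>s. scenario_set UNIV d W (T s) (h s)"
  have E: "scenario_set X d W (T s) (h s) = {q \<in> ?F s. fst q \<in> X}" for s
    by (auto simp: scenario_set_def)
  have "?V \<le> ereal (c * x + (\<Sum>s\<in>S. p s * \<theta> s))"
    if hull: "\<And>s. s \<in> S \<Longrightarrow> (x, \<theta> s) \<in> convex hull {q \<in> ?F s. fst q \<in> X}" for x \<theta>
  proof (cases "x \<in> X")
    case True
    have "(x, \<theta> s) \<in> ?F s" if "s \<in> S" for s
    proof -
      have "convex hull {q \<in> ?F s. fst q \<in> X} \<subseteq> ?F s"
        by (rule hull_minimal) (auto intro: convex_recourse_epigraph)
      with hull[OF that] show ?thesis by blast
    qed
    with True show ?thesis using S pos one by (intro two_stage_value_le_dual_point)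
  next
    case False
    obtain s0 where s0: "s0 \<in> S" using one by fastforce
    obtain l r where "l \<in> X" "l \<le> x" "r \<in> X" "x \<le> r"
      by (rule hull_of_slices_between[OF hull[OF s0]])
    then obtain a b where ab: "a \<in> X" "b \<in> X" "a < x" "x < b" "X \<inter> {a<..<b} = {}"
      by (rule closed_set_gap_around[OF X False])
    have "\<exists>\<alpha> \<beta>. (a, \<alpha>) \<in> ?F s \<and> (b, \<beta>) \<in> ?F s \<and>
        (b - a) * \<theta> s = (b - x) * \<alpha> + (x - a) * \<beta>" if "s \<in> S" for s
      by (rule hull_of_slices_over_gap[OF convex_recourse_epigraph ab(5,3,4) hull[OF that]]) blast
    then obtain \<alpha> \<beta> where
        \<alpha>: "\<And>s. s \<in> S \<Longrightarrow> (a, \<alpha> s) \<in> ?F s" and \<beta>: "\<And>s. s \<in> S \<Longrightarrow> (b, \<beta> s) \<in> ?F s"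
        and split: "\<And>s. s \<in> S \<Longrightarrow> (b - a) * \<theta> s = (b - x) * \<alpha> s + (x - a) * \<beta> s"
      by metis
    define A where "A = c * a + (\<Sum>s\<in>S. p s * \<alpha> s)"
    define B where "B = c * b + (\<Sum>s\<in>S. p s * \<beta> s)"
    define C where "C = c * x + (\<Sum>s\<in>S. p s * \<theta> s)"
    have "?V \<le> ereal A" "?V \<le> ereal B" unfolding A_def B_def
      using S pos one ab \<alpha> \<beta> by (auto intro!: two_stage_value_le_dual_point)
    \<comment> \<open>The dual value \<open>C\<close> is an average of \<open>A\<close> and \<open>B\<close> and hence not below both.\<close>
    then have V: "?V \<le> ereal (min A B)" by (simp add: min_def)
    have "(b - a) * C = (b - x) * A + (x - a) * B"
    proof -
      have "(b - a) * (\<Sum>s\<in>S. p s * \<theta> s) = (\<Sum>s\<in>S. p s * ((b - a) * \<theta> s))"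
        by (simp add: sum_distrib_left mult.left_commute)
      also have "\<dots> = (\<Sum>s\<in>S. p s * ((b - x) * \<alpha> s + (x - a) * \<beta> s))"
        by (intro sum.cong refl) (simp add: split)
      also have "\<dots> = (b - x) * (\<Sum>s\<in>S. p s * \<alpha> s) + (x - a) * (\<Sum>s\<in>S. p s * \<beta> s)"
        by (simp add: distrib_left sum.distrib sum_distrib_left mult.left_commute)
      finally show ?thesis by (simp add: A_def B_def C_def algebra_simps)
    qed
    moreover have "(b - x) * min A B + (x - a) * min A B \<le> (b - x) * A + (x - a) * B"
      using ab by (intro add_mono mult_left_mono) auto
    ultimately have "(b - a) * min A B \<le> (b - a) * C"
      by (simp add: algebra_simps)
    then have "min A B \<le> C" using ab by simp
    then have "ereal (min A B) \<le> ereal C" by (simp only: ereal_less_eq)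
    with V show ?thesis unfolding C_def by (rule order_trans)
  qed
  then show "?V \<le> lagrangian_dual_value S p X c d W T h"
    unfolding lagrangian_dual_value_def E by (auto intro!: INF_greatest)
next
  have "lagrangian_dual_value S p X c d W T h \<le> ereal (c * x + (\<Sum>s\<in>S. p s * (d \<bullet> y s)))"
    if "x \<in> X" "\<forall>s\<in>S. h s \<le> x *\<^sub>R T s + W *v y s \<and> 0 \<le> y s" for x and y :: "'a \<Rightarrow> real^'n"
  proof -
    have "(x, d \<bullet> y s) \<in> scenario_set X d W (T s) (h s)" if "s \<in> S" for s
      using that \<open>x \<in> X\<close> \<open>\<forall>s\<in>S. _\<close>
      by (auto simp: scenario_set_def recourse_cost_le_iff intro!: exI[of _ "y s"])
    then show ?thesis
      unfolding lagrangian_dual_value_def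
      by (intro INF_lower2[of "(x, \<lambda>s. d \<bullet> y s)"]) (auto intro: hull_inc)
  qed
  then show "lagrangian_dual_value S p X c d W T h \<le> two_stage_value S p X c d W T h"
    unfolding two_stage_value_def by (auto intro!: INF_greatest)
qed

section \<open>Monotonicity of the partition bound\<close>

text \<open>
  Clearing the denominator \<open>sum p P\<close> of the conditional means makes the constraint additive in the
  block, with \<open>sum p P *\<^sub>R y\<close> as the additive form of the decision variable.
\<close>

lemma aggregated_constraint_iff:
  fixes W :: "real^'n^'m"
  assumes "sum p P > 0"
  shows "cond_mean p h P \<le> x *\<^sub>R cond_mean p T P + W *v y \<longleftrightarrow>
    (\<Sum>s\<in>P. p s *\<^sub>R h s) \<le> x *\<^sub>R (\<Sum>s\<in>P. p s *\<^sub>R T s) + W *v (sum p P *\<^sub>R y)"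
proof -
  have "cond_mean p h P \<le> x *\<^sub>R cond_mean p T P + W *v y \<longleftrightarrow>
     sum p P *\<^sub>R cond_mean p h P \<le> sum p P *\<^sub>R (x *\<^sub>R cond_mean p T P + W *v y)"
    using assms by (simp add: scaleR_le_cancel_left_pos)
  then show ?thesis
    using assms by (simp add: cond_mean_def scaleR_add_right matrix_vector_mult_scaleR)
qed

lemma sum_over_partition_blocks:
  assumes "finite A" "partition_on A P"
  shows "sum f A = (\<Sum>B\<in>P. sum f B)"
proof -
  have "sum f (\<Union>P) = (\<Sum>B\<in>P. sum f B)"
    using assms by (subst sum.Union_disjoint)
      (auto simp: partition_on_def disjoint_def intro: finite_subset)
  then show ?thesis using assms(2) by (simp add: partition_on_def)
qed

lemma sum_grouped_by_coarser_blocks: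
  assumes S: "finite S" and ref: "refines S N1 N2"
  shows "(\<Sum>P\<in>N1. f P) = (\<Sum>Q\<in>N2. \<Sum>P\<in>{P \<in> N1. P \<subseteq> Q}. f P)"
proof -
  have fin: "finite N1" "finite N2"
    using S ref by (auto simp: refines_def partition_on_def finite_UnionD)
  have "(\<Union>Q\<in>N2. {P \<in> N1. P \<subseteq> Q}) = N1"
    using ref by (auto simp: refines_def)
  moreover have "{P \<in> N1. P \<subseteq> Q} \<inter> {P \<in> N1. P \<subseteq> Q'} = {}"
    if Q: "Q \<in> N2" "Q' \<in> N2" "Q \<noteq> Q'" for Q Q'
  proof (rule ccontr)
    assume "\<not> ?thesis"
    then obtain P where P: "P \<in> N1" "P \<subseteq> Q \<inter> Q'" by auto
    have "Q \<inter> Q' = {}"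
      using ref Q by (auto simp: refines_def partition_on_def disjoint_def)
    with P have "{} \<in> N1" by auto
    with ref show False by (auto simp: refines_def partition_on_def)
  qed
  ultimately show ?thesis
    using fin sum.UNION_disjoint[of N2 "\<lambda>Q. {P \<in> N1. P \<subseteq> Q}" f] by auto
qed

theorem partition_value_mono_refines:
  fixes d :: "real^'n" and W :: "real^'n^'m"
  assumes S: "finite S" and pos: "\<And>s. s \<in> S \<Longrightarrow> p s > 0" and ref: "refines S N1 N2"
  shows "partition_value N2 p X c d W T h \<le> partition_value N1 p X c d W T h"
proof -
  have block: "P \<subseteq> S \<and> P \<noteq> {}" if "P \<in> N1 \<union> N2" for P
    using ref that by (auto simp: refines_def partition_on_def)
  have mass: "sum p P > 0" if "P \<in> N1 \<union> N2" for P
    using block[OF that] S pos by (intro sum_pos) (auto intro: finite_subset)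
  have "partition_value N2 p X c d W T h \<le> ereal (c * x + (\<Sum>P\<in>N1. sum p P * (d \<bullet> y P)))"
    if x: "x \<in> X" and y: "\<forall>P\<in>N1. cond_mean p h P \<le> x *\<^sub>R cond_mean p T P + W *v y P \<and> 0 \<le> y P"
    for x and y :: "'a set \<Rightarrow> real^'n"
  proof -
    define sub where "sub = (\<lambda>Q. {P \<in> N1. P \<subseteq> Q})"
    \<comment> \<open>The conditional expectation of \<open>y\<close> given the coarser partition.\<close>
    define y' where "y' = (\<lambda>Q. (1 / sum p Q) *\<^sub>R (\<Sum>P\<in>sub Q. sum p P *\<^sub>R y P))"
    have y'_mass: "sum p Q *\<^sub>R y' Q = (\<Sum>P\<in>sub Q. sum p P *\<^sub>R y P)" if "Q \<in> N2" for Q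
      using mass[of Q] that by (simp add: y'_def)
    have feasible: "cond_mean p h Q \<le> x *\<^sub>R cond_mean p T Q + W *v y' Q \<and> 0 \<le> y' Q"
      if Q: "Q \<in> N2" for Q
    proof
      have "finite Q" using block Q S by (auto intro: finite_subset)
      moreover have "partition_on Q (sub Q)"
        unfolding sub_def by (rule refines_obtains_subset[OF ref Q])
      ultimately have split: "sum f Q = (\<Sum>P\<in>sub Q. sum f P)" for f :: "'a \<Rightarrow> real^'m"
        by (rule sum_over_partition_blocks)
      have "(\<Sum>P\<in>sub Q. \<Sum>s\<in>P. p s *\<^sub>R h s)
          \<le> (\<Sum>P\<in>sub Q. x *\<^sub>R (\<Sum>s\<in>P. p s *\<^sub>R T s) + W *v (sum p P *\<^sub>R y P))"
        using y mass by (intro sum_mono) (auto simp: sub_def simp flip: aggregated_constraint_iff)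
      also have "\<dots> = x *\<^sub>R (\<Sum>P\<in>sub Q. \<Sum>s\<in>P. p s *\<^sub>R T s)
          + W *v (\<Sum>P\<in>sub Q. sum p P *\<^sub>R y P)"
        by (simp add: sum.distrib scaleR_sum_right
            linear_sum[OF matrix_vector_mul_linear] del: matrix_vector_mult_scaleR)
      finally show "cond_mean p h Q \<le> x *\<^sub>R cond_mean p T Q + W *v y' Q"
        using mass[of Q] Q by (simp add: aggregated_constraint_iff y'_mass split)
      have "0 \<le> (\<Sum>P\<in>sub Q. sum p P *\<^sub>R y P)"
      proof (rule sum_nonneg)
        fix P assume "P \<in> sub Q"
        then have "P \<in> N1" by (simp add: sub_def)
        then show "0 \<le> sum p P *\<^sub>R y P"
          using y mass[of P] by (simp add: scaleR_nonneg_nonneg)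
      qed
      then show "0 \<le> y' Q"
        unfolding y'_def using mass[of Q] Q by (intro scaleR_nonneg_nonneg) auto
    qed
    have "(\<Sum>Q\<in>N2. sum p Q * (d \<bullet> y' Q)) = (\<Sum>Q\<in>N2. \<Sum>P\<in>sub Q. sum p P * (d \<bullet> y P))"
    proof (rule sum.cong)
      fix Q assume Q: "Q \<in> N2"
      have "sum p Q * (d \<bullet> y' Q) = d \<bullet> (sum p Q *\<^sub>R y' Q)" by simp
      also have "\<dots> = (\<Sum>P\<in>sub Q. sum p P * (d \<bullet> y P))"
        unfolding y'_mass[OF Q] by (simp add: inner_sum_right)
      finally show "sum p Q * (d \<bullet> y' Q) = (\<Sum>P\<in>sub Q. sum p P * (d \<bullet> y P))" .
    qed simp
    also have "\<dots> = (\<Sum>P\<in>N1. sum p P * (d \<bullet> y P))"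
      unfolding sub_def by (rule sum_grouped_by_coarser_blocks[OF S ref, symmetric])
    finally show ?thesis
      unfolding partition_value_def
      using x feasible by (intro INF_lower2[of "(x, y')"]) auto
  qed
  then show ?thesis
    unfolding partition_value_def[of N1] by (auto intro!: INF_greatest)
qed

section \<open>Integral first stage\<close>

theorem proposition3:
  fixes S :: "'s set" and p :: "'s \<Rightarrow> real" and X :: "real set"
    and c :: real and d :: "real^'n" and W :: "real^'n^'m"
    and T h :: "'s \<Rightarrow> real^'m"
  assumes "finite S"
    and "\<And>s. s \<in> S \<Longrightarrow> p s > 0"
    and "(\<Sum>s\<in>S. p s) = 1"
    and "X \<subseteq> \<int>"
  shows "two_stage_value S p X c d W T h = lagrangian_dual_value S p X c d W T h \<and>
         (\<forall>N1 N2. partition_on S N1 \<and> partition_on S N2 \<and> strictly_refines S N1 N2 \<longrightarrow>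
            partition_value N1 p X c d W T h \<ge> partition_value N2 p X c d W T h)"
proof (intro conjI allI impI)
  show "two_stage_value S p X c d W T h = lagrangian_dual_value S p X c d W T h"
    using assms(1-3) closed_subset_Ints[OF assms(4)]
    by (rule no_duality_gap_closed_first_stage)
next
  fix N1 N2 assume "partition_on S N1 \<and> partition_on S N2 \<and> strictly_refines S N1 N2"
  then have "refines S N1 N2" by (simp add: strictly_refines_def)
  with assms(1,2) show "partition_value N1 p X c d W T h \<ge> partition_value N2 p X c d W T h"
    by (rule partition_value_mono_refines)
qed

end
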